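(* Let $\Phi=(D,\varphi)$ be a $\mathbb{T}$-gain digraph on $n$ vertices in which every digon carries conjugate gains. Then $$\rho(\Phi)\ \ge\ \sqrt{\frac{2q}{n}},$$ where $q$ is the number of digons of $D$.
   Context: A digraph $D=(V,\mathcal{A})$ has a finite vertex set $V=\{v_1,\dots,v_n\}$ and a set $\mathcal{A}$ of ordered pairs of distinct vertices, called arcs (no loops; at most one arc from $v_i$ to $v_j$ for each ordered pair; opposite arcs may both be present). A digon is a directed cycle of length $2$, i.e. an unordered pair $\{v_i,v_j\}$ with both $(v_i,v_j)$ and $(v_j,v_i)$ in $\mathcal{A}$. Let $\mathbb{T}=\{z\in\mathbb{C}:|z|=1\}$. A $\mathbb{T}$-gain digraph is a pair $\Phi=(D,\varphi)$ with $\varphi:\mathcal{A}\to\mathbb{T}$ a function. A digon $\{v_i,v_j\}$ carries conjugate gains if $\varphi(v_j,v_i)=\overline{\varphi(v_i,v_j)}$. The gain adjacency matrix $A(\Phi)$ has entries $A(\Phi)_{ij}=\varphi(v_i,v_j)$ if $(v_i,v_j)\in\mathcal{A}$ and $0$ otherwise; $\rho(\Phi)$ is its spectral radius (maximum modulus of a complex eigenvalue). *)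

theory Defs
  imports "Graph_Theory.Pair_Digraph" "Jordan_Normal_Form.Spectral_Radius"
begin

(* The gain of the arc from u to v is phi (u, v); values of phi off the arc set are irrelevant. *)
locale unit_gain_digraph = pair_digraph G
  for G :: "'a pair_pre_digraph" +
  fixes \<phi> :: "'a \<times> 'a \<Rightarrow> complex"
  assumes gain_unit: "e \<in> parcs G \<Longrightarrow> cmod (\<phi> e) = 1"

definition digons :: "'a pair_pre_digraph \<Rightarrow> 'a set set" where
  "digons G = {{u, v} | u v. (u, v) \<in> parcs G \<and> (v, u) \<in> parcs G}"

definition carries_conjugate_gains ::
    "'a pair_pre_digraph \<Rightarrow> ('a \<times> 'a \<Rightarrow> complex) \<Rightarrow> 'a set \<Rightarrow> bool" where
  "carries_conjugate_gains G \<phi> d \<longleftrightarrow>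
     (\<forall>u v. d = {u, v} \<and> (u, v) \<in> parcs G \<and> (v, u) \<in> parcs G \<longrightarrow> \<phi> (v, u) = cnj (\<phi> (u, v)))"

(* The list vs is an enumeration of the vertex set; it fixes which row and column of the matrix
   belongs to which vertex. *)
definition gain_adjacency_matrix ::
    "'a pair_pre_digraph \<Rightarrow> ('a \<times> 'a \<Rightarrow> complex) \<Rightarrow> 'a list \<Rightarrow> complex mat" where
  "gain_adjacency_matrix G \<phi> vs =
     mat (length vs) (length vs)
       (\<lambda>(i, j). if (vs ! i, vs ! j) \<in> parcs G then \<phi> (vs ! i, vs ! j) else 0)"

end

theory Submission
  imports Defs
begin

text \<open>The trace of \<open>A(\<Phi>)\<^sup>2\<close> counts closed walks of length two weighted by their gains. Since there
  are no loops, these walks run back and forth along a digon, and conjugate gains give each of them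
  weight 1, so the trace is \<open>2q\<close>. It is also the sum of the squared eigenvalues, hence at most
  \<open>n \<rho>(\<Phi>)\<^sup>2\<close>.\<close>

definition mat_trace :: "'a :: comm_monoid_add mat \<Rightarrow> 'a" where
  "mat_trace A = (\<Sum>i<dim_row A. A $$ (i, i))"

lemma index_mult_mat_sum:
  assumes "A \<in> carrier_mat n m" "B \<in> carrier_mat m k" "i < n" "j < k"
  shows "(A * B) $$ (i, j) = (\<Sum>l<m. A $$ (i, l) * B $$ (l, j))"
  using assms by (auto simp: scalar_prod_def atLeast0LessThan intro!: sum.cong)

lemma mat_trace_mult:
  assumes "A \<in> carrier_mat n m" "B \<in> carrier_mat m n"
  shows "mat_trace (A * B) = (\<Sum>i<n. \<Sum>j<m. A $$ (i, j) * B $$ (j, i))"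
  using assms by (auto simp: mat_trace_def index_mult_mat_sum[OF assms] simp del: index_mult_mat(1)
      intro!: sum.cong)

lemma mat_trace_mult_commute:
  fixes A :: "'a :: comm_semiring_0 mat"
  assumes "A \<in> carrier_mat n m" "B \<in> carrier_mat m n"
  shows "mat_trace (A * B) = mat_trace (B * A)"
  unfolding mat_trace_mult[OF assms] mat_trace_mult[OF assms(2,1)]
  by (subst sum.swap) (simp add: mult.commute)

text \<open>Cyclicity of the trace moves \<open>P\<close> next to \<open>Q\<close>, where the two
  cancel.\<close>

lemma mat_trace_similar:
  fixes A :: "'a :: comm_semiring_1 mat"
  assumes "similar_mat A B"
  shows "mat_trace A = mat_trace B"
proof -
  obtain n P Q where carrier: "A \<in> carrier_mat n n" "B \<in> carrier_mat n n"
      "P \<in> carrier_mat n n" "Q \<in> carrier_mat n n"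
    and QP: "Q * P = 1\<^sub>m n" and A: "A = P * B * Q"
    using similar_matD[OF assms] by auto
  have "mat_trace A = mat_trace (P * (B * Q))"
    using carrier by (simp add: A)
  also have "\<dots> = mat_trace (B * Q * P)"
    using carrier by (intro mat_trace_mult_commute) auto
  also have "B * Q * P = B"
    using carrier by (simp add: QP)
  finally show ?thesis .
qed

text \<open>In the sum for a diagonal entry of the product, every term with \<open>l\<close>
  different from \<open>i\<close> has one factor strictly below the diagonal: the first if
  \<open>l < i\<close>, the second if \<open>l > i\<close>.\<close>

lemma upper_triangular_diag_mult:
  fixes B :: "'a :: comm_semiring_1 mat"
  assumes B: "B \<in> carrier_mat n n" and "upper_triangular B" and "i < n"
  shows "(B * B) $$ (i, i) = (B $$ (i, i))\<^sup>2"
proof -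
  have zero: "B $$ (i, l) * B $$ (l, i) = 0" if "l < n" "l \<noteq> i" for l
    using assms that by (cases "l < i") (auto simp: upper_triangular_def)
  have "(B * B) $$ (i, i) = (\<Sum>l<n. B $$ (i, l) * B $$ (l, i))"
    using assms by (intro index_mult_mat_sum) auto
  also have "\<dots> = (\<Sum>l\<in>{i}. B $$ (i, l) * B $$ (l, i))"
    using assms(3) zero by (intro sum.mono_neutral_right) auto
  finally show ?thesis by (simp add: power2_eq_square)
qed

text \<open>Schur triangularisation puts the eigenvalues on the diagonal of \<open>B\<close>, so
  that the trace of the square becomes a sum of \<open>n\<close> squared eigenvalues, bounded by the
  triangle inequality.\<close>

lemma norm_trace_square_le_spectral_radius:
  fixes A :: "complex mat"
  assumes A: "A \<in> carrier_mat n n" and "n > 0"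
  shows "cmod (mat_trace (A * A)) \<le> real n * (spectral_radius A)\<^sup>2"
proof -
  obtain es where "char_poly A = (\<Prod>a\<leftarrow>es. [:- a, 1:])"
    using char_poly_factorized[OF A] by blast
  then obtain B where B: "B \<in> carrier_mat n n" and ut: "upper_triangular B"
    and sim: "similar_mat A B"
    using schur_decomposition_exists[OF A] by blast
  have le: "cmod (B $$ (i, i)) \<le> spectral_radius A" if "i < n" for i
  proof -
    have "B $$ (i, i) \<in> set (diag_mat B)"
      using that B by (auto simp: diag_mat_def)
    \<comment> \<open>Similar matrices share their characteristic polynomial, and that of the
      triangular \<open>B\<close> is the product of linear factors with its diagonal entries as
      roots.\<close>
    then have "poly (char_poly A) (B $$ (i, i)) = 0"
      unfolding char_poly_similar[OF sim] char_poly_upper_triangular[OF B ut] poly_prod_list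
      by (force simp: prod_list_zero_iff)
    then have "B $$ (i, i) \<in> spectrum A"
      by (simp add: spectrum_root_char_poly[OF A])
    then show ?thesis
      using spectral_radius_mem_max(2)[OF assms] by blast
  qed
  have "similar_mat (A ^\<^sub>m 2) (B ^\<^sub>m 2)"
    using sim similar_mat_wit_pow unfolding similar_mat_def by blast
  then have "similar_mat (A * A) (B * B)"
    using A B by (simp add: numeral_2_eq_2)
  then have "mat_trace (A * A) = mat_trace (B * B)"
    by (rule mat_trace_similar)
  also have "\<dots> = (\<Sum>i<n. (B $$ (i, i))\<^sup>2)"
    using B upper_triangular_diag_mult[OF B ut] by (auto simp: mat_trace_def simp del: index_mult_mat(1))
  finally have "cmod (mat_trace (A * A)) \<le> (\<Sum>i<n. (cmod (B $$ (i, i)))\<^sup>2)"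
    by (metis (no_types, lifting) norm_power norm_sum sum.cong)
  also have "\<dots> \<le> (\<Sum>i<n. (spectral_radius A)\<^sup>2)"
    using le by (intro sum_mono power_mono) auto
  finally show ?thesis by simp
qed

text \<open>Forgetting the orientation maps \<open>?S\<close> onto the digons; the fibres
  \<open>?arcs d\<close> are disjoint and have two elements each.\<close>

lemma card_symmetric_arcs:
  assumes "pair_digraph G"
  shows "card {(u, v). (u, v) \<in> parcs G \<and> (v, u) \<in> parcs G} = 2 * card (digons G)"
proof -
  interpret pair_digraph G by fact
  let ?S = "{(u, v). (u, v) \<in> parcs G \<and> (v, u) \<in> parcs G}"
  let ?arcs = "\<lambda>d. {(u, v). d = {u, v}} \<inter> ?S"
  have digons: "digons G = (\<lambda>(u, v). {u, v}) ` ?S"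
    by (auto simp: digons_def)
  have fin: "finite ?S"
    by (rule finite_subset[OF _ pair_finite_arcs]) auto
  have "card (?arcs d) = 2" if d: "d \<in> digons G" for d
  proof -
    obtain u v where uv: "d = {u, v}" "(u, v) \<in> parcs G" "(v, u) \<in> parcs G"
      using d by (auto simp: digons_def)
    then have "?arcs d = {(u, v), (v, u)}"
      by (auto simp: doubleton_eq_iff)
    \<comment> \<open>Without loops the two orientations are distinct pairs, so the fibre does not
      collapse to one element.\<close>
    moreover have "u \<noteq> v"
      using uv(2) no_loops' by blast
    ultimately show ?thesis by simp
  qed
  moreover have "?S = (\<Union>d\<in>digons G. ?arcs d)"
    by (auto simp: digons_def)
  moreover have "card (\<Union>d\<in>digons G. ?arcs d) = (\<Sum>d\<in>digons G. card (?arcs d))"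
    using fin by (intro card_UN_disjoint) (auto simp: digons)
  ultimately show ?thesis by simp
qed

text \<open>Each term of the double sum for the trace is 1 if both arcs are present and 0 otherwise,
  so the trace counts the ordered pairs in \<open>?S\<close>, two per digon.\<close>

lemma trace_gain_adjacency_matrix_square:
  assumes "unit_gain_digraph G \<phi>" and "distinct vs" and "set vs = pverts G"
    and conj: "\<forall>d \<in> digons G. carries_conjugate_gains G \<phi> d"
  defines "A \<equiv> gain_adjacency_matrix G \<phi> vs"
  shows "mat_trace (A * A) = of_nat (2 * card (digons G))"
proof -
  interpret unit_gain_digraph G \<phi> by fact
  let ?n = "length vs"
  let ?S = "{(u, v). (u, v) \<in> parcs G \<and> (v, u) \<in> parcs G}"
  let ?g = "\<lambda>u v. if (u, v) \<in> ?S then 1 else 0 :: complex"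
  have A: "A \<in> carrier_mat ?n ?n"
    by (simp add: A_def gain_adjacency_matrix_def)
  have gain: "\<phi> (u, v) * \<phi> (v, u) = 1" if "(u, v) \<in> parcs G" "(v, u) \<in> parcs G" for u v
  proof -
    have "\<phi> (v, u) = cnj (\<phi> (u, v))"
      using that conj by (auto simp: digons_def carries_conjugate_gains_def)
    \<comment> \<open>The product is z times its conjugate, that is, the squared modulus of a unit
      gain.\<close>
    then show ?thesis
      using gain_unit[OF that(1)] by (simp add: complex_norm_square[symmetric])
  qed
  have bij: "bij_betw ((!) vs) {..<?n} (pverts G)"
    using assms by (intro bij_betw_nth) auto
  have "mat_trace (A * A) = (\<Sum>i<?n. \<Sum>j<?n. ?g (vs ! i) (vs ! j))"
    unfolding mat_trace_mult[OF A A]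
    by (intro sum.cong refl) (auto simp: A_def gain_adjacency_matrix_def gain)
  \<comment> \<open>Since \<open>vs\<close> lists every vertex once, sums over indices become sums
    over vertices.\<close>
  also have "\<dots> = (\<Sum>u\<in>pverts G. \<Sum>v\<in>pverts G. ?g u v)"
    by (simp only: sum.reindex_bij_betw[OF bij, of "\<lambda>v. ?g u v" for u]
        sum.reindex_bij_betw[OF bij, of "\<lambda>u. \<Sum>v\<in>pverts G. ?g u v"])
  also have "\<dots> = (\<Sum>e\<in>pverts G \<times> pverts G. if e \<in> ?S then 1 else 0)"
    by (simp add: sum.cartesian_product split_def)
  also have "\<dots> = of_nat (card ((pverts G \<times> pverts G) \<inter> ?S))"
    using pair_finite_verts by (simp add: sum.If_cases)
  also have "(pverts G \<times> pverts G) \<inter> ?S = ?S"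
    using arc_fst_in_verts arc_snd_in_verts by fastforce
  finally show ?thesis
    using card_symmetric_arcs[OF pair_digraph] by simp
qed

theorem theorem3p10:
  fixes G :: "'a pair_pre_digraph" and \<phi> :: "'a \<times> 'a \<Rightarrow> complex" and vs :: "'a list"
    and n :: nat
  assumes "unit_gain_digraph G \<phi>"
    and "pverts G \<noteq> {}"
    and "distinct vs" and "set vs = pverts G"
    and "n = card (pverts G)"
    and "\<forall>d \<in> digons G. carries_conjugate_gains G \<phi> d"
  shows "spectral_radius (gain_adjacency_matrix G \<phi> vs) \<ge> sqrt (2 * real (card (digons G)) / real n)"
proof -
  let ?A = "gain_adjacency_matrix G \<phi> vs"
  have n: "n = length vs" "n > 0"
    using assms(2,5) distinct_card[OF assms(3)] unfolding assms(4)[symmetric] by auto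
  then have A: "?A \<in> carrier_mat n n"
    by (simp add: gain_adjacency_matrix_def)
  have "cmod (mat_trace (?A * ?A)) = 2 * real (card (digons G))"
    using trace_gain_adjacency_matrix_square[OF assms(1,3,4,6)] by (simp only: norm_of_nat)
  then have "2 * real (card (digons G)) / real n \<le> (spectral_radius ?A)\<^sup>2"
    using norm_trace_square_le_spectral_radius[OF A n(2)] n(2) by (simp add: field_simps)
  \<comment> \<open>Taking the square root of the bound requires this sign; as \<open>n > 0\<close>,
    the spectral radius is the modulus of an actual eigenvalue.\<close>
  moreover have "0 \<le> spectral_radius ?A"
    using spectral_radius_mem_max(1)[OF A n(2)] by auto
  ultimately show ?thesis
    by (rule real_le_lsqrt[rotated])
qed

end
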